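(* Let $\mathcal{E}$ be an evolution algebra over a field $\mathbb{F}$ with $ann(\mathcal{E})\neq 0$. Then $\mathcal{E}$ is (isomorphic to) an annihilator extension of an evolution algebra of lower dimension.
   Context: An evolution algebra over $\mathbb{F}$ is a (finite-dimensional, not necessarily associative) algebra $\mathcal{E}$ having a vector space basis $\{e_1,\dots,e_m\}$, called a natural basis, with $e_ie_j=0$ for all $i\neq j$ (the zero algebra, with empty natural basis, is allowed). The annihilator is $ann(\mathcal{E})=\{x\in\mathcal{E}:x\mathcal{E}=0\}$. Let $\mathcal{M}$ be an evolution algebra with natural basis $\{e_1,\dots,e_m\}$, let $V$ be a vector space with basis $\{e_{m+1},\dots,e_n\}$, and let $\theta:\mathcal{M}\times\mathcal{M}\to V$ be a bilinear map with $\theta(e_i,e_j)=0$ for all $i\neq j$. The annihilator extension $\mathcal{M}_\theta$ of $\mathcal{M}$ by $V$ is the vector space $\mathcal{M}\oplus V$ with the bilinear multiplication $e_i\star e_j=e_ie_j+\theta(e_i,e_j)$ if $1\le i,j\le m$ and $e_i\star e_j=0$ otherwise; it is an evolution algebra with natural basis $\{e_1,\dots,e_n\}$. *)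

theory Defs
  imports "Jordan_Normal_Form.Missing_VectorSpace"
begin

definition bilinear_map ::
  "('k, 'r) ring_scheme \<Rightarrow> ('k, 'a, 'p) module_scheme \<Rightarrow> ('k, 'b, 'q) module_scheme \<Rightarrow>
   ('k, 'c, 's) module_scheme \<Rightarrow> ('a \<Rightarrow> 'b \<Rightarrow> 'c) \<Rightarrow> bool"
  where "bilinear_map K U V W f \<longleftrightarrow>
    (\<forall>x\<in>carrier U. (\<lambda>y. f x y) \<in> module_hom K V W) \<and>
    (\<forall>y\<in>carrier V. (\<lambda>x. f x y) \<in> module_hom K U W)"

text \<open>The library locale \<open>algebra\<close> is commutative, associative and unital. Here the record
  type of modules is used with its field \<open>mult\<close> as the product; the field \<open>one\<close> is ignored.\<close>

locale nonassoc_algebra = vectorspace K A for K and A (structure) +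
  assumes bilinear_mult: "bilinear_map K A A A (mult A)"

definition natural_basis ::
  "('k, 'r) ring_scheme \<Rightarrow> ('k, 'a, 'p) module_scheme \<Rightarrow> 'a set \<Rightarrow> bool"
  where "natural_basis K A B \<longleftrightarrow> finite B \<and> vectorspace.basis K A B \<and>
    (\<forall>b\<in>B. \<forall>c\<in>B. b \<noteq> c \<longrightarrow> b \<otimes>\<^bsub>A\<^esub> c = \<zero>\<^bsub>A\<^esub>)"

locale evolution_algebra = nonassoc_algebra K A for K and A (structure) +
  assumes ex_natural_basis: "\<exists>B. natural_basis K A B"

definition annihilator :: "('k, 'a, 'p) module_scheme \<Rightarrow> 'a set"
  where "annihilator A = {x \<in> carrier A. \<forall>y\<in>carrier A. x \<otimes>\<^bsub>A\<^esub> y = \<zero>\<^bsub>A\<^esub>}"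

definition algebra_iso ::
  "('k, 'r) ring_scheme \<Rightarrow> ('k, 'a, 'p) module_scheme \<Rightarrow> ('k, 'b, 'q) module_scheme \<Rightarrow>
   ('a \<Rightarrow> 'b) set"
  where "algebra_iso K A A' = {f \<in> module_hom K A A'. bij_betw f (carrier A) (carrier A') \<and>
    (\<forall>x\<in>carrier A. \<forall>y\<in>carrier A. f (x \<otimes>\<^bsub>A\<^esub> y) = f x \<otimes>\<^bsub>A'\<^esub> f y)}"

text \<open>The product below is the bilinear extension of the rule that two vectors \<open>b\<close>, \<open>c\<close> of the
  natural basis of \<open>M\<close> have product \<open>b c + \<theta>(b, c)\<close> and that all products involving a basis
  vector of \<open>V\<close> vanish; see the lemmas in the locale \<open>annihilator_extension\<close>.\<close>

definition ann_ext ::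
  "('k, 'a) module \<Rightarrow> ('k, 'b) module \<Rightarrow> ('a \<Rightarrow> 'a \<Rightarrow> 'b) \<Rightarrow> ('k, 'a \<times> 'b) module"
  where "ann_ext M V \<theta> =
    (direct_sum M V)\<lparr>mult := \<lambda>p q. (fst p \<otimes>\<^bsub>M\<^esub> fst q, \<theta> (fst p) (fst q))\<rparr>"

locale annihilator_extension = M: nonassoc_algebra K M + V: vectorspace K V
  for K :: "('k, 'r) ring_scheme" and M :: "('k, 'a) module" and B :: "'a set"
    and V :: "('k, 'b) module" and \<theta> :: "'a \<Rightarrow> 'a \<Rightarrow> 'b" +
  assumes natural_basis: "natural_basis K M B"
    and fin_dim: "V.fin_dim"
    and bilinear: "bilinear_map K M M V \<theta>"
    and orthogonal: "\<And>b c. b \<in> B \<Longrightarrow> c \<in> B \<Longrightarrow> b \<noteq> c \<Longrightarrow> \<theta> b c = \<zero>\<^bsub>V\<^esub>"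
begin

sublocale M: evolution_algebra K M
  using natural_basis by unfold_locales blast

lemma module_hom_zero:
  assumes "module K N" "module K P" "f \<in> module_hom K N P"
  shows "f \<zero>\<^bsub>N\<^esub> = \<zero>\<^bsub>P\<^esub>"
  using assms by (intro mod_hom.f0_is_0[of K]) (simp add: mod_hom_def mod_hom_axioms_def)

lemma ann_ext_mult_inj1:
  "inj1 M V x \<otimes>\<^bsub>ann_ext M V \<theta>\<^esub> inj1 M V y
    = inj1 M V (x \<otimes>\<^bsub>M\<^esub> y) \<oplus>\<^bsub>ann_ext M V \<theta>\<^esub> inj2 M V (\<theta> x y)"
  if "x \<in> carrier M" "y \<in> carrier M"
proof -
  have "x \<otimes>\<^bsub>M\<^esub> y \<in> carrier M" "\<theta> x y \<in> carrier V"
    using that bilinear M.bilinear_mult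
    by (auto simp: bilinear_map_def module_hom_def)
  then show ?thesis
    by (simp add: ann_ext_def direct_sum_def inj1_def inj2_def)
qed

lemma ann_ext_mult_inj2:
  assumes "v \<in> carrier V" "p \<in> carrier (ann_ext M V \<theta>)"
  shows "inj2 M V v \<otimes>\<^bsub>ann_ext M V \<theta>\<^esub> p = \<zero>\<^bsub>ann_ext M V \<theta>\<^esub>"
    and "p \<otimes>\<^bsub>ann_ext M V \<theta>\<^esub> inj2 M V v = \<zero>\<^bsub>ann_ext M V \<theta>\<^esub>"
proof -
  have p: "fst p \<in> carrier M"
    using assms by (auto simp: ann_ext_def direct_sum_def)
  note homs = bilinear M.bilinear_mult p
  have "fst p \<otimes>\<^bsub>M\<^esub> \<zero>\<^bsub>M\<^esub> = \<zero>\<^bsub>M\<^esub>"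
    using homs by (intro module_hom_zero[of M M "\<lambda>y. fst p \<otimes>\<^bsub>M\<^esub> y"])
      (auto simp: bilinear_map_def M.module_axioms)
  moreover have "\<zero>\<^bsub>M\<^esub> \<otimes>\<^bsub>M\<^esub> fst p = \<zero>\<^bsub>M\<^esub>"
    using homs by (intro module_hom_zero[of M M "\<lambda>x. x \<otimes>\<^bsub>M\<^esub> fst p"])
      (auto simp: bilinear_map_def M.module_axioms)
  moreover have "\<theta> (fst p) \<zero>\<^bsub>M\<^esub> = \<zero>\<^bsub>V\<^esub>"
    using homs by (intro module_hom_zero[of M V "\<lambda>y. \<theta> (fst p) y"])
      (auto simp: bilinear_map_def M.module_axioms V.module_axioms)
  moreover have "\<theta> \<zero>\<^bsub>M\<^esub> (fst p) = \<zero>\<^bsub>V\<^esub>"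
    using homs by (intro module_hom_zero[of M V "\<lambda>x. \<theta> x (fst p)"])
      (auto simp: bilinear_map_def M.module_axioms V.module_axioms)
  ultimately show "inj2 M V v \<otimes>\<^bsub>ann_ext M V \<theta>\<^esub> p = \<zero>\<^bsub>ann_ext M V \<theta>\<^esub>"
    and "p \<otimes>\<^bsub>ann_ext M V \<theta>\<^esub> inj2 M V v = \<zero>\<^bsub>ann_ext M V \<theta>\<^esub>"
    by (simp_all add: ann_ext_def direct_sum_def inj2_def)
qed

lemma bilinear_ann_ext_mult:
  "bilinear_map K (ann_ext M V \<theta>) (ann_ext M V \<theta>) (ann_ext M V \<theta>) (mult (ann_ext M V \<theta>))"
  using bilinear M.bilinear_mult
  by (auto simp: bilinear_map_def module_hom_def ann_ext_def direct_sum_def Pi_iff)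

end

end

theory Submission
  imports Defs
begin

text \<open>Let \<open>B\<close> be a natural basis of \<open>E\<close> and \<open>C\<close> the set of those \<open>b \<in> B\<close> with \<open>b\<^sup>2 \<noteq> 0\<close>. Multiplying
  \<open>x = \<Sum> a\<^sub>b b\<close> by \<open>c \<in> B\<close>, on either side, leaves only \<open>a\<^sub>c c\<^sup>2\<close>. Hence \<open>x\<close> annihilates
  \<open>E\<close> exactly if \<open>a\<^sub>c = 0\<close> for all \<open>c \<in> C\<close>, so that \<open>E\<close> is the direct sum of \<open>span C\<close> and the
  annihilator (\<open>annihilator_complement\<close>), and the annihilator kills \<open>E\<close> from both sides
  (\<open>annihilator_two_sided\<close>).

  Let \<open>p\<close> and \<open>q\<close> be the projections onto the two summands. The quotient algebra of \<open>E\<close> by its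
  annihilator is realised inside \<open>E\<close> as \<open>M = span C\<close> with the product \<open>p (x y)\<close>; for it \<open>C\<close> is a
  natural basis. The vector space \<open>V\<close> is the annihilator, and the part of the product lost by
  projecting is the cocycle \<open>\<theta> x y = q (x y)\<close>. As annihilator components do not affect products,
  \<open>x y = (p x) (p y)\<close>, and therefore \<open>x \<mapsto> (p x, q x)\<close> is an isomorphism of \<open>E\<close> with the
  extension of \<open>M\<close> by \<open>\<theta>\<close>. A nonzero annihilator forces \<open>C \<noteq> B\<close>, and \<open>M\<close> has dimension
  \<open>card C < card B\<close>.\<close>

section \<open>Linear maps and complementary subspaces\<close>

lemma (in mod_hom) ker_contains_span:
  assumes "S \<subseteq> carrier M" "\<And>v. v \<in> S \<Longrightarrow> f v = \<zero>\<^bsub>N\<^esub>" "x \<in> M.span S"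
  shows "f x = \<zero>\<^bsub>N\<^esub>"
proof -
  have "S \<subseteq> ker" using assms(1,2) by (auto simp: ker_def)
  then have "M.span S \<subseteq> ker" by (rule M.span_is_subset[OF _ ker_is_submodule])
  then show ?thesis using assms(3) by (auto simp: ker_def)
qed

text \<open>The form in which orthogonality of a natural basis is used: multiplication by a basis vector
  is a linear map that vanishes on all other basis vectors.\<close>

lemma (in mod_hom) hom_lincomb_single:
  assumes S: "finite S" "S \<subseteq> carrier M" and a: "a \<in> S \<rightarrow> carrier R" and c: "c \<in> S"
    and zero: "\<And>v. v \<in> S \<Longrightarrow> v \<noteq> c \<Longrightarrow> f v = \<zero>\<^bsub>N\<^esub>"
  shows "f (M.lincomb a S) = a c \<odot>\<^bsub>N\<^esub> f c"
proof -
  have T: "S - {c} \<subseteq> carrier M" "a \<in> S - {c} \<rightarrow> carrier R" using S a by auto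
  have rest: "f (M.lincomb a (S - {c})) = \<zero>\<^bsub>N\<^esub>"
  proof (rule ker_contains_span[OF T(1)])
    show "M.lincomb a (S - {c}) \<in> M.span (S - {c})"
      using S(1) T(2) unfolding M.span_def by blast
  qed (use zero in simp)
  have mem: "c \<in> carrier M" "a c \<in> carrier R" using S a c by auto
  have "f (M.lincomb a S) = f (a c \<odot>\<^bsub>M\<^esub> c \<oplus>\<^bsub>M\<^esub> M.lincomb a (S - {c}))"
    by (subst M.lincomb_del2[OF S a c]) simp
  also have "\<dots> = a c \<odot>\<^bsub>N\<^esub> f c"
    using mem T rest by simp
  finally show ?thesis .
qed

text \<open>Every vector has exactly one decomposition along a pair of complementary subspaces, and sums
  and scalar multiples of decompositions are again decompositions, so uniqueness makes both
  components linear. Values in the subspaces regarded as spaces of their own are what the summands of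
  an external direct sum require.\<close>

lemma (in vectorspace) complement_decomposition:
  assumes U: "subspace K U V" and W: "subspace K W V"
    and disj: "U \<inter> W \<subseteq> {\<zero>\<^bsub>V\<^esub>}" and sum: "carrier V \<subseteq> subspace_sum U W"
  obtains p q where "p \<in> module_hom K V (vs U)" "q \<in> module_hom K V (vs W)"
    "\<And>x. x \<in> carrier V \<Longrightarrow> x = p x \<oplus>\<^bsub>V\<^esub> q x"
    "\<And>u w. u \<in> U \<Longrightarrow> w \<in> W \<Longrightarrow> p (u \<oplus>\<^bsub>V\<^esub> w) = u \<and> q (u \<oplus>\<^bsub>V\<^esub> w) = w"
proof -
  interpret U: submodule K U V using U by (rule is_module)
  interpret W: submodule K W V using W by (rule is_module)
  note sub = subsetD[OF U.subset] subsetD[OF W.subset]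
  have uniq: "u = u' \<and> w = w'"
    if h: "u \<in> U" "u' \<in> U" "w \<in> W" "w' \<in> W" "u \<oplus>\<^bsub>V\<^esub> w = u' \<oplus>\<^bsub>V\<^esub> w'" for u u' w w'
  proof -
    have c: "u \<in> carrier V" "u' \<in> carrier V" "w \<in> carrier V" "w' \<in> carrier V"
      using h sub by auto
    have "u \<ominus>\<^bsub>V\<^esub> u' = (u \<oplus>\<^bsub>V\<^esub> w) \<ominus>\<^bsub>V\<^esub> w \<ominus>\<^bsub>V\<^esub> u'"
      using c by (simp add: a_minus_def M.a_assoc M.r_neg)
    also have "\<dots> = (u' \<ominus>\<^bsub>V\<^esub> u') \<oplus>\<^bsub>V\<^esub> (w' \<ominus>\<^bsub>V\<^esub> w)"
      using c unfolding h(5) by (simp add: a_minus_def M.a_ac)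
    also have "\<dots> = w' \<ominus>\<^bsub>V\<^esub> w"
      using c by (simp add: a_minus_def M.r_neg)
    \<comment> \<open>The common value lies in both subspaces.\<close>
    finally have "u \<ominus>\<^bsub>V\<^esub> u' = w' \<ominus>\<^bsub>V\<^esub> w" .
    moreover have "u \<ominus>\<^bsub>V\<^esub> u' \<in> U" "w' \<ominus>\<^bsub>V\<^esub> w \<in> W"
      using h c by (auto simp: a_minus_def smult_minus_1[symmetric])
    ultimately have "u \<ominus>\<^bsub>V\<^esub> u' = \<zero>\<^bsub>V\<^esub>" "w' \<ominus>\<^bsub>V\<^esub> w = \<zero>\<^bsub>V\<^esub>"
      using disj by auto
    then show ?thesis
      using c M.minus_equality M.minus_minus by (metis M.a_inv_closed a_minus_def)
  qed
  define g where "g x = (SOME uw. uw \<in> U \<times> W \<and> x = fst uw \<oplus>\<^bsub>V\<^esub> snd uw)" for x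
  have g: "g x \<in> U \<times> W" "x = fst (g x) \<oplus>\<^bsub>V\<^esub> snd (g x)" if "x \<in> carrier V" for x
  proof -
    have "\<exists>uw. uw \<in> U \<times> W \<and> x = fst uw \<oplus>\<^bsub>V\<^esub> snd uw"
    proof -
      have "x \<in> (\<lambda>(u, w). u \<oplus>\<^bsub>V\<^esub> w) ` {(u, w). u \<in> U \<and> w \<in> W}"
        using that sum unfolding submodule_sum_def by (rule subsetD[rotated])
      then show ?thesis by (simp add: image_iff case_prod_beta mem_Times_iff Bex_def)
    qed
    then have "g x \<in> U \<times> W \<and> x = fst (g x) \<oplus>\<^bsub>V\<^esub> snd (g x)"
      unfolding g_def by (rule someI_ex)
    then show "g x \<in> U \<times> W" "x = fst (g x) \<oplus>\<^bsub>V\<^esub> snd (g x)" by blast+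
  qed
  have g_sum: "g (u \<oplus>\<^bsub>V\<^esub> w) = (u, w)" if "u \<in> U" "w \<in> W" for u w
  proof -
    have "u \<oplus>\<^bsub>V\<^esub> w \<in> carrier V" using that sub by simp
    note gs = g[OF this]
    have "u = fst (g (u \<oplus>\<^bsub>V\<^esub> w)) \<and> w = snd (g (u \<oplus>\<^bsub>V\<^esub> w))"
      using that gs by (intro uniq) (simp_all add: mem_Times_iff)
    then show ?thesis by (metis prod.collapse)
  qed
  have mem: "fst (g x) \<in> U" "snd (g x) \<in> W" if "x \<in> carrier V" for x
    using g(1)[OF that] by (simp_all add: mem_Times_iff)
  have add: "g (x \<oplus>\<^bsub>V\<^esub> y) = (fst (g x) \<oplus>\<^bsub>V\<^esub> fst (g y), snd (g x) \<oplus>\<^bsub>V\<^esub> snd (g y))"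
    if x: "x \<in> carrier V" and y: "y \<in> carrier V" for x y
  proof -
    have "x \<oplus>\<^bsub>V\<^esub> y = (fst (g x) \<oplus>\<^bsub>V\<^esub> snd (g x)) \<oplus>\<^bsub>V\<^esub> (fst (g y) \<oplus>\<^bsub>V\<^esub> snd (g y))"
      by (simp flip: g(2)[OF x] g(2)[OF y])
    also have "\<dots> = (fst (g x) \<oplus>\<^bsub>V\<^esub> fst (g y)) \<oplus>\<^bsub>V\<^esub> (snd (g x) \<oplus>\<^bsub>V\<^esub> snd (g y))"
      using mem[OF x] mem[OF y] sub by (simp add: M.a_ac)
    finally show ?thesis using mem[OF x] mem[OF y] g_sum by simp
  qed
  have smult: "g (r \<odot>\<^bsub>V\<^esub> x) = (r \<odot>\<^bsub>V\<^esub> fst (g x), r \<odot>\<^bsub>V\<^esub> snd (g x))"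
    if r: "r \<in> carrier K" and x: "x \<in> carrier V" for r x
  proof -
    have "r \<odot>\<^bsub>V\<^esub> x = r \<odot>\<^bsub>V\<^esub> (fst (g x) \<oplus>\<^bsub>V\<^esub> snd (g x))"
      by (simp flip: g(2)[OF x])
    also have "\<dots> = r \<odot>\<^bsub>V\<^esub> fst (g x) \<oplus>\<^bsub>V\<^esub> r \<odot>\<^bsub>V\<^esub> snd (g x)"
      using mem[OF x] r sub by (simp add: smult_r_distr)
    finally show ?thesis using mem[OF x] r g_sum by simp
  qed
  show thesis
  proof (rule that[of "fst \<circ> g" "snd \<circ> g"])
    show "fst \<circ> g \<in> module_hom K V (vs U)" "snd \<circ> g \<in> module_hom K V (vs W)"
      using mem add smult by (simp_all add: module_hom_def)
    show "x = (fst \<circ> g) x \<oplus>\<^bsub>V\<^esub> (snd \<circ> g) x" if "x \<in> carrier V" for x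
      unfolding comp_def using that by (rule g(2))
    show "(fst \<circ> g) (u \<oplus>\<^bsub>V\<^esub> w) = u \<and> (snd \<circ> g) (u \<oplus>\<^bsub>V\<^esub> w) = w"
      if "u \<in> U" "w \<in> W" for u w
      by (simp add: g_sum[OF that])
  qed
qed

section \<open>Changing the product of a module record\<close>

text \<open>The record of a module carries a product that the module axioms do not constrain. Linear
  algebra is therefore the same in a subspace of an algebra and in that subspace with a new product.\<close>

lemma module_mult_update [simp]: "module K (A\<lparr>mult := m\<rparr>) \<longleftrightarrow> module K A"
  by (simp add: module_def module_axioms_def abelian_group_def abelian_monoid_def
      abelian_group_axioms_def)

lemma vectorspace_mult_update [simp]: "vectorspace K (A\<lparr>mult := m\<rparr>) \<longleftrightarrow> vectorspace K A"
  by (simp add: vectorspace_def)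

lemma basis_mult_update:
  assumes "vectorspace K A"
  shows "vectorspace.basis K (A\<lparr>mult := m\<rparr>) S \<longleftrightarrow> vectorspace.basis K A S"
proof -
  interpret A: vectorspace K A by fact
  interpret A': vectorspace K "A\<lparr>mult := m\<rparr>" using assms by simp
  have lincomb: "A'.lincomb a T = A.lincomb a T" for a T
    by (simp add: A.lincomb_def A'.lincomb_def finsum_def)
  show ?thesis
    by (simp add: A.basis_def A'.basis_def A.lin_dep_def A'.lin_dep_def A.span_def A'.span_def
        lincomb)
qed

section \<open>The annihilator of an evolution algebra\<close>

context nonassoc_algebra
begin

lemma mod_hom_mult_left: "x \<in> carrier A \<Longrightarrow> mod_hom K A A (\<lambda>y. x \<otimes> y)"
  using bilinear_mult module_axioms
  by (simp add: bilinear_map_def mod_hom_def mod_hom_axioms_def)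

lemma mod_hom_mult_right: "y \<in> carrier A \<Longrightarrow> mod_hom K A A (\<lambda>x. x \<otimes> y)"
  using bilinear_mult module_axioms
  by (simp add: bilinear_map_def mod_hom_def mod_hom_axioms_def)

lemma mult_closed: "x \<in> carrier A \<Longrightarrow> y \<in> carrier A \<Longrightarrow> x \<otimes> y \<in> carrier A"
  using mod_hom.f_im[OF mod_hom_mult_left] .

lemma annihilator_subspace: "subspace K (annihilator A) A"
proof -
  note hom = mod_hom.f_hom[OF mod_hom_mult_right]
  have "submodule K (annihilator A) A"
    by (rule submodule.intro)
      (auto simp: annihilator_def module_axioms module_hom_add[OF hom] module_hom_smult[OF hom]
        mod_hom.f0_is_0[OF mod_hom_mult_right])
  then show ?thesis by (simp add: subspace_def vectorspace_axioms)
qed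

lemma natural_basisD:
  assumes "natural_basis K A B"
  shows "finite B" "B \<subseteq> carrier A" "lin_indpt B" "span B = carrier A"
    "\<And>b c. b \<in> B \<Longrightarrow> c \<in> B \<Longrightarrow> b \<noteq> c \<Longrightarrow> b \<otimes> c = \<zero>"
  using assms[unfolded natural_basis_def basis_def] by (iprover dest: bspec)+

lemma mult_lincomb_natural_basis:
  assumes B: "natural_basis K A B" and a: "a \<in> B \<rightarrow> carrier K" and c: "c \<in> B"
  shows "lincomb a B \<otimes> c = a c \<odot> (c \<otimes> c)" "c \<otimes> lincomb a B = a c \<odot> (c \<otimes> c)"
proof -
  note fin = natural_basisD(1,2)[OF B] and orth = natural_basisD(5)[OF B]
  have mem: "c \<in> carrier A" using fin(2) c by (rule subsetD)
  show "lincomb a B \<otimes> c = a c \<odot> (c \<otimes> c)"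
    using mod_hom.hom_lincomb_single[OF mod_hom_mult_right[OF mem] fin a c] orth c by metis
  show "c \<otimes> lincomb a B = a c \<odot> (c \<otimes> c)"
    using mod_hom.hom_lincomb_single[OF mod_hom_mult_left[OF mem] fin a c] orth c by metis
qed

text \<open>The annihilator is defined by products \<open>x y\<close> only. A basis vector \<open>c\<close> has the same product
  with \<open>x\<close> in either order, so \<open>y \<mapsto> y x\<close> vanishes on the basis as well.\<close>

lemma annihilator_two_sided:
  assumes B: "natural_basis K A B" and x: "x \<in> annihilator A" and y: "y \<in> carrier A"
  shows "y \<otimes> x = \<zero>"
proof -
  note fin = natural_basisD(1,2)[OF B] and gen = natural_basisD(4)[OF B]
  have xA: "x \<in> carrier A" and ann: "\<And>y. y \<in> carrier A \<Longrightarrow> x \<otimes> y = \<zero>"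
    using x by (simp_all add: annihilator_def)
  obtain a where a: "a \<in> B \<rightarrow> carrier K" "lincomb a B = x"
    using finite_in_span[OF fin, of x] xA gen by metis
  have "c \<otimes> x = \<zero>" if "c \<in> B" for c
    using mult_lincomb_natural_basis[OF B a(1) that] ann[of c] subsetD[OF fin(2) that] a(2) by metis
  then show ?thesis
    using mod_hom.ker_contains_span[OF mod_hom_mult_right[OF xA] fin(2)] y gen by metis
qed

text \<open>The sum is direct because a combination of \<open>C\<close> with coefficients \<open>a\<close> has the product
  \<open>a\<^sub>c c\<^sup>2\<close> with \<open>c\<close>, and \<open>c\<^sup>2 \<noteq> 0\<close>. It is everything because a basis vector outside \<open>C\<close> is
  orthogonal to the whole basis, itself included.\<close>

lemma annihilator_complement:
  assumes B: "natural_basis K A B"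
  defines "C \<equiv> {b \<in> B. b \<otimes> b \<noteq> \<zero>}"
  shows "span C \<inter> annihilator A \<subseteq> {\<zero>}"
    and "carrier A \<subseteq> subspace_sum (span C) (annihilator A)"
proof -
  note fin = natural_basisD(1,2)[OF B] and gen = natural_basisD(4)[OF B]
    and orth = natural_basisD(5)[OF B]
  have C: "finite C" "C \<subseteq> carrier A" "C \<subseteq> B"
  proof -
    show "C \<subseteq> B" by (simp add: C_def)
    then show "finite C" "C \<subseteq> carrier A" using fin by (metis finite_subset, metis subset_trans)
  qed
  show "span C \<inter> annihilator A \<subseteq> {\<zero>}"
  proof
    fix x assume "x \<in> span C \<inter> annihilator A"
    then have x: "x \<in> span C" "x \<in> annihilator A" by simp_all
    then obtain a where a: "a \<in> C \<rightarrow> carrier K" "lincomb a C = x"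
      using finite_in_span[OF C(1,2), of x] by metis
    have "a c = \<zero>\<^bsub>K\<^esub>" if c: "c \<in> C" for c
    proof -
      have cA: "c \<in> carrier A" and ac: "a c \<in> carrier K"
        using c C(2) a(1) by (metis subsetD, metis Pi_mem)
      have "a c \<odot> (c \<otimes> c) = lincomb a C \<otimes> c"
        using mod_hom.hom_lincomb_single[OF mod_hom_mult_right[OF cA] C(1,2) a(1) c] orth c C(3)
        by (metis subsetD)
      also have "\<dots> = \<zero>" using a(2) x(2) cA by (simp add: annihilator_def)
      finally have eq: "a c \<odot> (c \<otimes> c) = \<zero>" .
      show ?thesis
      proof (rule ccontr)
        assume "a c \<noteq> \<zero>\<^bsub>K\<^esub>"
        with eq ac have "c \<otimes> c = inv\<^bsub>K\<^esub> (a c) \<odot> \<zero>"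
          using mult_closed[OF cA cA] by (intro mult_inverse)
        with ac \<open>a c \<noteq> \<zero>\<^bsub>K\<^esub>\<close> have "c \<otimes> c = \<zero>" by simp
        with c show False by (simp add: C_def)
      qed
    qed
    then have "lincomb a C = \<zero>" using C(2) by (intro lincomb_zero Pi_I) simp_all
    with a(2) show "x \<in> {\<zero>}" by simp
  qed
  have subs: "subspace K (span C) A" using C(2) by (rule span_is_subspace)
  have "b \<in> subspace_sum (span C) (annihilator A)" if b: "b \<in> B" for b
  proof (cases "b \<in> C")
    case True
    then show ?thesis
      using in_sum_vs[OF subs annihilator_subspace] in_own_span[OF C(2)] by (metis subsetD)
  next
    case False
    have bA: "b \<in> carrier A" using fin(2) b by (rule subsetD)
    have "b \<otimes> c = \<zero>" if "c \<in> B" for c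
      using False b that orth[of b c] by (cases "b = c") (simp_all add: C_def)
    then have "b \<otimes> y = \<zero>" if "y \<in> carrier A" for y
      using mod_hom.ker_contains_span[OF mod_hom_mult_left[OF bA] fin(2)] that gen by metis
    then have "b \<in> annihilator A" using bA by (simp add: annihilator_def)
    then show ?thesis
      using in_sum_vs[OF annihilator_subspace subs] vsum_comm[OF subs annihilator_subspace]
      by (metis subsetD)
  qed
  then have "span B \<subseteq> subspace_sum (span C) (annihilator A)"
    using is_module[OF sum_is_subspace[OF subs annihilator_subspace]]
    by (intro span_is_subset subsetI)
  then show "carrier A \<subseteq> subspace_sum (span C) (annihilator A)" using gen by simp
qed

end

theorem lemma9:
  fixes K :: "('k, 'r) ring_scheme" and E :: "('k, 'e) module"
  assumes "evolution_algebra K E"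
    and "annihilator E \<noteq> {\<zero>\<^bsub>E\<^esub>}"
  shows "\<exists>(M :: ('k, 'e) module) B (V :: ('k, 'e) module) \<theta> f.
    annihilator_extension K M B V \<theta> \<and>
    vectorspace.dim K M < vectorspace.dim K E \<and>
    f \<in> algebra_iso K E (ann_ext M V \<theta>)"
proof -
  interpret E: evolution_algebra K E by fact
  obtain B where B: "natural_basis K E B" using E.ex_natural_basis by blast
  note fin = E.natural_basisD(1,2)[OF B] and indpt = E.natural_basisD(3)[OF B]
    and gen = E.natural_basisD(4)[OF B] and orth = E.natural_basisD(5)[OF B]
  have basis: "E.basis B" unfolding E.basis_def by (intro conjI indpt gen fin)
  define C where "C = {b \<in> B. b \<otimes>\<^bsub>E\<^esub> b \<noteq> \<zero>\<^bsub>E\<^esub>}"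
  define U where "U = E.span C"
  define W where "W = annihilator E"
  have CB: "C \<subseteq> B" by (simp add: C_def)
  have C: "finite C" "C \<subseteq> carrier E"
    using CB fin by (metis finite_subset, metis subset_trans)
  have CU: "C \<subseteq> U" unfolding U_def by (rule E.in_own_span[OF C(2)])
  have U: "subspace K U E" unfolding U_def using C(2) by (rule E.span_is_subspace)
  have W: "subspace K W E" unfolding W_def by (rule E.annihilator_subspace)
  have disj: "U \<inter> W \<subseteq> {\<zero>\<^bsub>E\<^esub>}" and sum: "carrier E \<subseteq> E.subspace_sum U W"
    using E.annihilator_complement[OF B] by (simp_all add: U_def W_def C_def)
  obtain p q where p: "p \<in> module_hom K E (E.vs U)" and q: "q \<in> module_hom K E (E.vs W)"
    and pq: "\<And>x. x \<in> carrier E \<Longrightarrow> x = p x \<oplus>\<^bsub>E\<^esub> q x"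
    and pq_sum: "\<And>u w. u \<in> U \<Longrightarrow> w \<in> W \<Longrightarrow> p (u \<oplus>\<^bsub>E\<^esub> w) = u \<and> q (u \<oplus>\<^bsub>E\<^esub> w) = w"
    using E.complement_decomposition[OF U W disj sum] by blast
  interpret U: vectorspace K "E.vs U" by (rule E.subspace_is_vs[OF U])
  interpret W: vectorspace K "E.vs W" by (rule E.subspace_is_vs[OF W])
  interpret p: linear_map K E "E.vs U" p by unfold_locales (rule p)
  interpret q: linear_map K E "E.vs W" q by unfold_locales (rule q)
  have sub: "U \<subseteq> carrier E" "W \<subseteq> carrier E"
    by (rule submodule.subset[OF E.is_module[OF U]], rule submodule.subset[OF E.is_module[OF W]])
  have pU: "p x \<in> U" and qW: "q x \<in> W" if "x \<in> carrier E" for x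
    using p.f_im[OF that] q.f_im[OF that] by simp_all
  have W0: "w \<otimes>\<^bsub>E\<^esub> y = \<zero>\<^bsub>E\<^esub>" "y \<otimes>\<^bsub>E\<^esub> w = \<zero>\<^bsub>E\<^esub>" if "w \<in> W" "y \<in> carrier E" for w y
    using that E.annihilator_two_sided[OF B, of w y] by (simp_all add: W_def annihilator_def)
  \<comment> \<open>A complement of the annihilator need not be a subalgebra, so products are projected back.\<close>
  define M where "M = E\<lparr>carrier := U, mult := \<lambda>x y. p (x \<otimes>\<^bsub>E\<^esub> y)\<rparr>"
  define V where "V = E\<lparr>carrier := W\<rparr>"
  define \<theta> where "\<theta> x y = q (x \<otimes>\<^bsub>E\<^esub> y)" for x y
  have M_eq: "M = E.vs U\<lparr>mult := \<lambda>x y. p (x \<otimes>\<^bsub>E\<^esub> y)\<rparr>" by (simp add: M_def)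
  interpret M: vectorspace K M
    unfolding M_eq vectorspace_mult_update by (rule U.vectorspace_axioms)
  interpret V: vectorspace K V unfolding V_def by (rule W.vectorspace_axioms)
  note mult_homs = mod_hom.f_hom[OF E.mod_hom_mult_left] mod_hom.f_hom[OF E.mod_hom_mult_right]
  have bil_M: "bilinear_map K M M M (mult M)" and bil_V: "bilinear_map K M M V \<theta>"
    using sub pU qW
    by (auto simp: bilinear_map_def module_hom_def M_def V_def \<theta>_def subset_iff E.mult_closed
      module_hom_add[OF mult_homs(1)] module_hom_add[OF mult_homs(2)]
      module_hom_smult[OF mult_homs(1)] module_hom_smult[OF mult_homs(2)]
      module_hom_add[OF p] module_hom_add[OF q] module_hom_smult[OF p] module_hom_smult[OF q])
  have "E.lin_indpt C" using indpt CB by (rule E.subset_li_is_li)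
  then have "U.basis C"
    unfolding U.basis_def using E.span_li_not_depend[OF CU E.is_module[OF U]] CU by (simp add: U_def)
  then have basis_C: "M.basis C"
    unfolding M_eq using U.vectorspace_axioms by (simp add: basis_mult_update)
  have nat_C: "natural_basis K M C"
    unfolding natural_basis_def
  proof (intro conjI ballI impI)
    fix b c assume "b \<in> C" "c \<in> C" "b \<noteq> c"
    then have "b \<otimes>\<^bsub>E\<^esub> c = \<zero>\<^bsub>E\<^esub>" using orth CB by (metis subsetD)
    then show "b \<otimes>\<^bsub>M\<^esub> c = \<zero>\<^bsub>M\<^esub>" using p.f0_is_0 by (simp add: M_def)
  qed (rule C(1) basis_C)+
  \<comment> \<open>The annihilator is finite-dimensional as the image of \<open>E\<close> under \<open>q\<close>.\<close>
  have "W = q ` carrier E"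
  proof -
    have "q w = w" if "w \<in> W" for w
    proof -
      have "w \<in> carrier E" using sub(2) that by (rule subsetD)
      moreover have "\<zero>\<^bsub>E\<^esub> \<in> U" using U.M.zero_closed by simp
      ultimately show ?thesis using pq_sum[of "\<zero>\<^bsub>E\<^esub>" w] that by simp
    qed
    then show ?thesis using qW sub(2)
      by (metis image_iff image_subsetI subsetD subsetI subset_antisym)
  qed
  moreover have "E.fin_dim" unfolding E.fin_dim_def by (intro exI[of _ B] conjI fin gen)
  ultimately have fin_V: "V.fin_dim" unfolding V_def by (intro q.surj_fin_dim) simp_all
  have ext: "annihilator_extension K M C V \<theta>"
  proof unfold_locales
    fix b c assume "b \<in> C" "c \<in> C" "b \<noteq> c"
    then have "b \<otimes>\<^bsub>E\<^esub> c = \<zero>\<^bsub>E\<^esub>" using orth CB by (metis subsetD)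
    then show "\<theta> b c = \<zero>\<^bsub>V\<^esub>" using q.f0_is_0 by (simp add: \<theta>_def V_def)
  qed (rule bil_M nat_C bil_V fin_V)+
  have "C \<noteq> B"
  proof
    assume "C = B"
    then have "U = carrier E" using gen by (simp add: U_def)
    then have "W \<subseteq> {\<zero>\<^bsub>E\<^esub>}" using disj sub(2) by (simp add: Int_absorb1)
    moreover have "\<zero>\<^bsub>E\<^esub> \<in> W" using W.M.zero_closed by simp
    ultimately show False using assms(2) by (auto simp: W_def)
  qed
  then have "card C < card B" using CB fin(1) by (intro psubset_card_mono psubsetI)
  then have dim: "M.dim < E.dim"
    using M.dim_basis[OF C(1) basis_C] E.dim_basis[OF fin(1) basis] by simp
  define f where "f x = (p x, q x)" for x
  have mult_p: "p x \<otimes>\<^bsub>E\<^esub> p y = x \<otimes>\<^bsub>E\<^esub> y" if x: "x \<in> carrier E" and y: "y \<in> carrier E" for x y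
  proof -
    have mem: "p x \<in> carrier E" "p y \<in> carrier E" "q x \<in> carrier E" "q y \<in> carrier E"
      using pU[OF x] pU[OF y] qW[OF x] qW[OF y] sub by (simp_all add: subset_iff)
    have "x \<otimes>\<^bsub>E\<^esub> y = (p x \<oplus>\<^bsub>E\<^esub> q x) \<otimes>\<^bsub>E\<^esub> y" by (simp flip: pq[OF x])
    also have "\<dots> = p x \<otimes>\<^bsub>E\<^esub> y"
      using mem y W0(1)[OF qW[OF x] y] by (simp add: module_hom_add[OF mult_homs(2)] E.mult_closed)
    also have "\<dots> = p x \<otimes>\<^bsub>E\<^esub> (p y \<oplus>\<^bsub>E\<^esub> q y)" by (simp flip: pq[OF y])
    also have "\<dots> = p x \<otimes>\<^bsub>E\<^esub> p y"
      using mem W0(2)[OF qW[OF y] mem(1)]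
      by (simp add: module_hom_add[OF mult_homs(1)] E.mult_closed)
    finally show ?thesis by simp
  qed
  have "bij_betw f (carrier E) (U \<times> W)"
    by (rule bij_betw_byWitness[where f' = "\<lambda>z. fst z \<oplus>\<^bsub>E\<^esub> snd z"])
      (use pq_sum pU qW sub in \<open>auto simp: f_def pq[symmetric] subset_iff intro!: E.M.a_closed\<close>)
  then have "f \<in> algebra_iso K E (ann_ext M V \<theta>)"
    using pU qW mult_p
    by (auto simp: algebra_iso_def module_hom_def ann_ext_def direct_sum_def M_def V_def \<theta>_def f_def
      module_hom_add[OF p] module_hom_add[OF q] module_hom_smult[OF p] module_hom_smult[OF q])
  with ext dim show ?thesis by blast
qed

end
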